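(* Let $G^{N}$ be a probe graph on $n$ vertices. Then $\operatorname{mr}(G^{N})=1$ if and only if $G=(K_a\vee\overline{K_b})\cup\overline{K_c}$ where $a+b+c=n$, $a>0$, and if $b\ge 2$, then $V(\overline{K_b})\subseteq N$.
   Context: Graphs are finite, simple and undirected. For a graph $G$, $\mathcal S(G)$ is the set of real symmetric matrices indexed by $V(G)$ whose off-diagonal $ij$ entry is nonzero if and only if $ij\in E(G)$; diagonal entries are arbitrary real numbers. A probe graph $G^{N}$ is a graph $G$ with an independent set $N\subseteq V(G)$ of non-probe vertices. $\mathcal S(G^{N})$ is the union of $\mathcal S(H)$ over all graphs $H$ obtained from $G$ by adding any number of edges (possibly none) between vertices of $N$. $\operatorname{mr}(G^{N})$ is the minimum rank of a matrix in $\mathcal S(G^{N})$. Here $a,b,c$ are non-negative integers, $K_m$ is the complete graph on $m$ vertices, $\overline{K_m}$ is its complement (the edgeless graph on $m$ vertices), $\vee$ denotes the join, and $\cup$ the disjoint union of graphs.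
   Formalization: The condition a+b≥2 is added next to a>0: for a=1, b=0 the graph G is edgeless, so the zero matrix gives mr(G^N)=0 and the printed equivalence fails; only that case is excluded. *)

theory Defs
  imports "HOL-Analysis.Analysis"
begin

record 'a graph =
  verts :: "'a set"
  edges :: "'a set set"

definition all_edges :: "'a set \<Rightarrow> 'a set set" where
  "all_edges V = {e. e \<subseteq> V \<and> card e = 2}"

definition simple_graph :: "'a graph \<Rightarrow> bool" where
  "simple_graph G \<longleftrightarrow> finite (verts G) \<and> edges G \<subseteq> all_edges (verts G)"

definition independent_set :: "'a graph \<Rightarrow> 'a set \<Rightarrow> bool" where
  "independent_set G N \<longleftrightarrow> N \<subseteq> verts G \<and> (\<forall>x\<in>N. \<forall>y\<in>N. {x, y} \<notin> edges G)"

definition complete_graph :: "nat \<Rightarrow> nat graph" where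
  "complete_graph m = \<lparr>verts = {..<m}, edges = all_edges {..<m}\<rparr>"

definition graph_complement :: "'a graph \<Rightarrow> 'a graph" where
  "graph_complement G = \<lparr>verts = verts G, edges = all_edges (verts G) - edges G\<rparr>"

definition graph_union :: "'a graph \<Rightarrow> 'b graph \<Rightarrow> ('a + 'b) graph" where
  "graph_union G H =
     \<lparr>verts = verts G <+> verts H,
      edges = (image Inl) ` edges G \<union> (image Inr) ` edges H\<rparr>"

definition graph_join :: "'a graph \<Rightarrow> 'b graph \<Rightarrow> ('a + 'b) graph" where
  "graph_join G H =
     \<lparr>verts = verts G <+> verts H,
      edges = (image Inl) ` edges G \<union> (image Inr) ` edges H
              \<union> {{Inl x, Inr y} | x y. x \<in> verts G \<and> y \<in> verts H}\<rparr>"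

definition graph_iso :: "('a \<Rightarrow> 'b) \<Rightarrow> 'a graph \<Rightarrow> 'b graph \<Rightarrow> bool" where
  "graph_iso f G H \<longleftrightarrow> bij_betw f (verts G) (verts H) \<and>
     (\<forall>x\<in>verts G. \<forall>y\<in>verts G. {x, y} \<in> edges G \<longleftrightarrow> {f x, f y} \<in> edges H)"

(* Rows and columns are indexed by the whole type 'n, so this is the set S(G) of the
   literature only for graphs with verts G = UNIV. *)
definition sym_matrices :: "'n::finite graph \<Rightarrow> (real^'n^'n) set" where
  "sym_matrices G =
     {A. transpose A = A \<and> (\<forall>i j. i \<noteq> j \<longrightarrow> (A $ i $ j \<noteq> 0 \<longleftrightarrow> {i, j} \<in> edges G))}"

definition probe_graph :: "'a graph \<Rightarrow> 'a set \<Rightarrow> bool" where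
  "probe_graph G N \<longleftrightarrow> simple_graph G \<and> independent_set G N"

definition probe_completions :: "'a graph \<Rightarrow> 'a set \<Rightarrow> 'a graph set" where
  "probe_completions G N =
     {H. simple_graph H \<and> verts H = verts G \<and> edges G \<subseteq> edges H \<and>
         edges H - edges G \<subseteq> all_edges N}"

definition probe_matrices :: "'n::finite graph \<Rightarrow> 'n set \<Rightarrow> (real^'n^'n) set" where
  "probe_matrices G N = (\<Union>H\<in>probe_completions G N. sym_matrices H)"

definition probe_mr :: "'n::finite graph \<Rightarrow> 'n set \<Rightarrow> nat" where
  "probe_mr G N = (LEAST r. \<exists>A\<in>probe_matrices G N. rank A = r)"

end

theory Submission
  imports Defs
begin

text \<open>A matrix of rank one is an outer product, so its nonzero entries fill a rectangle of positions;
  if the matrix is symmetric, this rectangle is a square \<open>S \<times> S\<close>.  Hence a graph with a matrix of rank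
  one is a clique on \<open>S\<close> together with isolated vertices, and a probe graph has minimum rank one
  precisely when it has an edge and can be completed to such a graph by adding edges inside \<open>N\<close>.

  Given such a completion, removing the added edges separates \<open>S\<close> into \<open>A = S - N\<close> and
  \<open>B = S \<inter> N\<close>: all pairs inside \<open>S\<close> with an end outside \<open>N\<close> are edges of the original graph, whereas the
  independence of \<open>N\<close> makes \<open>B\<close> edgeless.  This is the join of a clique on \<open>A\<close> and the edgeless graph
  on \<open>B\<close>, plus isolated vertices.  Conversely, if the graph has this shape, then filling in the pairs
  inside \<open>B\<close> makes \<open>A \<union> B\<close> a clique, and the 0/1 matrix supported on \<open>(A \<union> B) \<times> (A \<union> B)\<close> has rank one.
  The filled pairs lie inside \<open>N\<close>: if \<open>B\<close> has at most one element there are none, and otherwise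
  \<open>B \<subseteq> N\<close> by assumption.  That \<open>A\<close> is nonempty and \<open>A \<union> B\<close> has at least two elements says that
  the graph has an edge, which excludes the zero matrix.

  The linear algebra is in \<open>rank_1_imp_support_rectangle\<close> and \<open>rank_outer_product_le_1\<close>, the argument
  just given in \<open>probe_mr_eq_1_iff\<close>.  What remains is to translate between such a pair \<open>A\<close>, \<open>B\<close> of
  vertex sets and an isomorphism from the graph built by join and union.\<close>

section \<open>Supports of matrices of rank one\<close>

lemma rank_1_imp_support_rectangle:
  fixes M :: "real^'n^'m"
  assumes "rank M = 1"
  obtains R C where "\<And>i j. M $ i $ j \<noteq> 0 \<longleftrightarrow> i \<in> R \<and> j \<in> C" and "R \<noteq> {}" and "C \<noteq> {}"
proof -
  obtain B where B: "columns M \<subseteq> span B" "card B = dim (columns M)"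
    using basis_exists[of "columns M"] by metis
  then have "card B = 1"
    using assms by (simp add: column_rank_def)
  then obtain v where v: "B = {v}"
    by (auto simp: card_1_singleton_iff)
  have "\<exists>k. column j M = k *\<^sub>R v" for j
    using B(1) v by (auto simp: columns_def span_singleton)
  then obtain w where w: "\<And>j. column j M = w j *\<^sub>R v"
    by metis
  have entry: "M $ i $ j = w j * v $ i" for i j
    using arg_cong[OF w[of j], of "\<lambda>x. x $ i"] by (simp add: column_def)
  have "M \<noteq> 0"
    using assms by auto
  then obtain i j where "M $ i $ j \<noteq> 0"
    by (auto simp: vec_eq_iff)
  then show ?thesis
    using that[of "{i. v $ i \<noteq> 0}" "{j. w j \<noteq> 0}"] by (auto simp: entry)
qed

lemma symmetric_rank_1_imp_support_square:
  fixes M :: "real^'n^'n"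
  assumes "transpose M = M" and "rank M = 1"
  obtains S where "\<And>i j. M $ i $ j \<noteq> 0 \<longleftrightarrow> i \<in> S \<and> j \<in> S"
proof -
  obtain R C where RC: "\<And>i j. M $ i $ j \<noteq> 0 \<longleftrightarrow> i \<in> R \<and> j \<in> C" "R \<noteq> {}" "C \<noteq> {}"
    using rank_1_imp_support_rectangle[OF assms(2)] by metis
  have "M $ i $ j = M $ j $ i" for i j
    using assms(1) by (metis transpose_def vec_lambda_beta)
  \<comment> \<open>A nonempty rectangle that is invariant under swapping coordinates is a square.\<close>
  then have "R = C"
    using RC by (metis subset_antisym subset_iff ex_in_conv)
  then show ?thesis
    using that RC(1) by blast
qed

lemma rank_outer_product_le_1:
  fixes u :: "real^'m" and w :: "real^'n"
  shows "rank (\<chi> i j. u $ i * w $ j) \<le> 1"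
proof -
  have "columns (\<chi> i j. u $ i * w $ j) \<subseteq> span {u}"
    by (auto simp: columns_def column_def span_singleton vec_eq_iff mult.commute)
  then have "dim (columns (\<chi> i j. u $ i * w $ j)) \<le> card {u}"
    by (rule dim_le_card) simp
  then show ?thesis
    by (simp add: column_rank_def)
qed

section \<open>Minimum rank one\<close>

text \<open>For disjoint \<open>A\<close> and \<open>B\<close>, this is the join of a clique on \<open>A\<close> and an edgeless graph on \<open>B\<close>,
  together with isolated vertices.  Describing it by vertex sets of the graph itself keeps isomorphisms
  out of the argument about ranks.\<close>

definition clique_join_coclique :: "'a graph \<Rightarrow> 'a set \<Rightarrow> 'a set \<Rightarrow> bool" where
  "clique_join_coclique G A B \<longleftrightarrow>
     (\<forall>x y. {x, y} \<in> edges G \<longleftrightarrow> x \<noteq> y \<and> x \<in> A \<union> B \<and> y \<in> A \<union> B \<and> \<not> (x \<in> B \<and> y \<in> B))"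

lemma simple_graph_no_loop: "simple_graph G \<Longrightarrow> {x, x} \<notin> edges G"
  by (auto simp: simple_graph_def all_edges_def)

lemma simple_graph_edge_in_verts:
  "simple_graph G \<Longrightarrow> {x, y} \<in> edges G \<Longrightarrow> x \<in> verts G \<and> y \<in> verts G"
  by (auto simp: simple_graph_def all_edges_def)

lemma simple_graph_edge_pair:
  assumes "simple_graph G" and "e \<in> edges G"
  obtains x y where "e = {x, y}" and "x \<noteq> y"
proof -
  have "card e = 2"
    using assms by (auto simp: simple_graph_def all_edges_def)
  then show ?thesis
    using that by (auto simp: card_2_iff)
qed

lemma graph_in_probe_completions: "simple_graph G \<Longrightarrow> G \<in> probe_completions G N"
  by (simp add: probe_completions_def)

lemma sym_matrices_nonempty: "\<exists>M. M \<in> sym_matrices H"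
  by (rule exI[of _ "\<chi> i j. if {i, j} \<in> edges H then 1 else 0"])
    (auto simp: sym_matrices_def transpose_def vec_eq_iff insert_commute)

text \<open>Rank zero is attained exactly by edgeless graphs: completing a graph with an edge keeps that edge,
  and its matrix entry is nonzero.  So minimum rank one means that there is an edge
  and that rank one is attained.\<close>

lemma zero_in_probe_matrices_iff:
  fixes G :: "'n::finite graph"
  assumes "simple_graph G"
  shows "0 \<in> probe_matrices G N \<longleftrightarrow> edges G = {}"
proof
  assume "0 \<in> probe_matrices G N"
  then obtain H :: "'n graph" where H: "edges G \<subseteq> edges H" "\<And>i j. i \<noteq> j \<Longrightarrow> {i, j} \<notin> edges H"
    by (auto simp: probe_matrices_def probe_completions_def sym_matrices_def)
  have "\<exists>i j. e = {i, j} \<and> i \<noteq> j" if "e \<in> edges G" for e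
    using simple_graph_edge_pair[OF assms that] by metis
  then show "edges G = {}"
    using H by blast
next
  assume "edges G = {}"
  then have "0 \<in> sym_matrices G"
    by (auto simp: sym_matrices_def transpose_def vec_eq_iff)
  then show "0 \<in> probe_matrices G N"
    using graph_in_probe_completions[OF assms] by (auto simp: probe_matrices_def)
qed

lemma probe_mr_eq_1_iff_rank_1:
  fixes G :: "'n::finite graph"
  assumes "simple_graph G"
  shows "probe_mr G N = 1 \<longleftrightarrow> edges G \<noteq> {} \<and> (\<exists>M\<in>probe_matrices G N. rank M = 1)"
    (is "_ \<longleftrightarrow> ?rhs")
proof -
  let ?P = "\<lambda>r. \<exists>M\<in>probe_matrices G N. rank M = r"
  have zero: "?P 0 \<longleftrightarrow> edges G = {}"
    using zero_in_probe_matrices_iff[OF assms, of N] by (simp add: rank_eq_0)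
  obtain M where "M \<in> probe_matrices G N"
    using sym_matrices_nonempty[of G] graph_in_probe_completions[OF assms]
    by (auto simp: probe_matrices_def)
  then have P_mr: "?P (probe_mr G N)"
    unfolding probe_mr_def by (intro LeastI[of ?P "rank M"] bexI[of _ M]) auto
  have mr_le: "?P r \<Longrightarrow> probe_mr G N \<le> r" for r
    unfolding probe_mr_def by (rule Least_le)
  show ?thesis
  proof
    assume mr: "probe_mr G N = 1"
    then have "\<not> ?P 0"
      using mr_le[of 0] by linarith
    then show ?rhs
      using P_mr mr zero by simp
  next
    assume ?rhs
    then have "probe_mr G N \<le> 1" "probe_mr G N \<noteq> 0"
      using mr_le[of 1] P_mr zero by auto
    then show "probe_mr G N = 1"
      by linarith
  qed
qed

lemma rank_1_imp_clique_join_coclique: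
  assumes "probe_graph G N" and "M \<in> probe_matrices G N" and "rank M = 1"
  obtains S where "clique_join_coclique G (S - N) (S \<inter> N)"
proof -
  have G: "simple_graph G" "independent_set G N"
    using assms(1) by (auto simp: probe_graph_def)
  obtain H where H: "edges G \<subseteq> edges H" "edges H - edges G \<subseteq> all_edges N" "M \<in> sym_matrices H"
    using assms(2) by (auto simp: probe_matrices_def probe_completions_def)
  obtain S where S: "\<And>i j. M $ i $ j \<noteq> 0 \<longleftrightarrow> i \<in> S \<and> j \<in> S"
    using symmetric_rank_1_imp_support_square[OF _ assms(3)] H(3)
    by (auto simp: sym_matrices_def)
  have edge_H: "{i, j} \<in> edges H \<longleftrightarrow> i \<in> S \<and> j \<in> S" if "i \<noteq> j" for i j
    using H(3) S that by (auto simp: sym_matrices_def)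
  have "{i, j} \<in> edges G \<longleftrightarrow> i \<in> S \<and> j \<in> S \<and> \<not> (i \<in> N \<and> j \<in> N)" if "i \<noteq> j" for i j
    using edge_H[OF that] H(1,2) G(2) by (auto simp: all_edges_def independent_set_def)
  then have "clique_join_coclique G (S - N) (S \<inter> N)"
    using simple_graph_no_loop[OF G(1)] unfolding clique_join_coclique_def
    by (metis IntD2 IntI Un_Diff_Int)
  then show ?thesis
    using that by blast
qed

lemma clique_join_coclique_imp_rank_1:
  fixes G :: "'n::finite graph"
  assumes "simple_graph G" and "verts G = UNIV" and "edges G \<noteq> {}"
    and G: "clique_join_coclique G A B" and B: "card B \<ge> 2 \<Longrightarrow> B \<subseteq> N"
  shows "\<exists>M\<in>probe_matrices G N. rank M = 1"
proof -
  define H where "H = \<lparr>verts = UNIV :: 'n set, edges = all_edges (A \<union> B)\<rparr>"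
  define M :: "real^'n^'n" where
    "M = (\<chi> i j. (\<chi> k. of_bool (k \<in> A \<union> B)) $ i * (\<chi> k. of_bool (k \<in> A \<union> B)) $ j)"
  have edge_G: "{x, y} \<in> edges G \<longleftrightarrow>
      x \<noteq> y \<and> x \<in> A \<union> B \<and> y \<in> A \<union> B \<and> \<not> (x \<in> B \<and> y \<in> B)" for x y
    using G by (auto simp: clique_join_coclique_def)
  have pair: "\<exists>x y. e = {x, y}" if "e \<in> edges G" for e
    using simple_graph_edge_pair[OF assms(1) that] by metis
  have edge_H: "{x, y} \<in> edges H \<longleftrightarrow> x \<noteq> y \<and> x \<in> A \<union> B \<and> y \<in> A \<union> B" for x y
    by (auto simp: H_def all_edges_def card_insert_if)
  have sub: "edges G \<subseteq> edges H"
    using pair edge_G edge_H by blast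
  have added: "{x, y} \<in> all_edges N" if "{x, y} \<in> edges H - edges G" for x y
  proof -
    have xy: "x \<noteq> y" "x \<in> B" "y \<in> B"
      using that edge_G edge_H by auto
    \<comment> \<open>The mere existence of an added edge forces two elements into \<open>B\<close>.\<close>
    then have "card {x, y} \<le> card B"
      by (intro card_mono) auto
    then show ?thesis
      using xy B by (auto simp: all_edges_def)
  qed
  have "edges H - edges G \<subseteq> all_edges N"
  proof
    fix e assume e: "e \<in> edges H - edges G"
    then obtain x y where "e = {x, y}"
      by (auto simp: H_def all_edges_def card_2_iff)
    then show "e \<in> all_edges N"
      using added e by blast
  qed
  moreover have "simple_graph H"
    by (auto simp: H_def simple_graph_def all_edges_def)
  ultimately have "H \<in> probe_completions G N"
    using sub assms(2) by (auto simp: probe_completions_def H_def)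
  moreover have "M \<in> sym_matrices H"
    by (auto simp: sym_matrices_def M_def transpose_def vec_eq_iff edge_H)
  ultimately have M: "M \<in> probe_matrices G N"
    by (auto simp: probe_matrices_def)
  have "rank M \<le> 1"
    unfolding M_def by (rule rank_outer_product_le_1)
  moreover have "rank M \<noteq> 0"
    using M zero_in_probe_matrices_iff[OF assms(1), of N] assms(3) by (metis rank_eq_0)
  ultimately show ?thesis
    using M by (intro bexI[of _ M]) auto
qed

lemma clique_join_coclique_has_edge_iff:
  assumes "simple_graph G" and "clique_join_coclique G A B" and "finite A" and "finite B"
  shows "edges G \<noteq> {} \<longleftrightarrow> A - B \<noteq> {} \<and> card (A \<union> B) \<ge> 2"
proof -
  have edge: "{x, y} \<in> edges G \<longleftrightarrow>
      x \<noteq> y \<and> x \<in> A \<union> B \<and> y \<in> A \<union> B \<and> \<not> (x \<in> B \<and> y \<in> B)" for x y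
    using assms(2) by (auto simp: clique_join_coclique_def)
  show ?thesis
  proof
    assume "edges G \<noteq> {}"
    then obtain x y where xy: "{x, y} \<in> edges G"
      using simple_graph_edge_pair[OF assms(1)] by (metis equals0I)
    then have "card {x, y} \<le> card (A \<union> B)"
      using assms(3,4) edge by (intro card_mono) auto
    then show "A - B \<noteq> {} \<and> card (A \<union> B) \<ge> 2"
      using xy edge by auto
  next
    assume *: "A - B \<noteq> {} \<and> card (A \<union> B) \<ge> 2"
    then obtain x where x: "x \<in> A" "x \<notin> B"
      by auto
    have "A \<union> B \<noteq> {x}"
      using * by auto
    then obtain y where "y \<in> A \<union> B" "y \<noteq> x"
      using x by auto
    then have "{x, y} \<in> edges G"
      using edge x by blast
    then show "edges G \<noteq> {}"
      by auto
  qed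
qed

text \<open>If a matrix of rank one has support \<open>S \<times> S\<close>, then \<open>A = S - N\<close> and \<open>B = S \<inter> N\<close> are such sets.\<close>

lemma probe_mr_eq_1_iff:
  fixes G :: "'n::finite graph"
  assumes "probe_graph G N" and "verts G = UNIV"
  shows "probe_mr G N = 1 \<longleftrightarrow>
    (\<exists>A B. A \<inter> B = {} \<and> A \<noteq> {} \<and> card (A \<union> B) \<ge> 2 \<and> clique_join_coclique G A B \<and>
       (card B \<ge> 2 \<longrightarrow> B \<subseteq> N))"
    (is "_ \<longleftrightarrow> ?rhs")
proof -
  have G: "simple_graph G"
    using assms(1) by (simp add: probe_graph_def)
  have diff: "A - B = A" if "A \<inter> B = {}" for A B :: "'n set"
    using that by auto
  show ?thesis
  proof
    assume "probe_mr G N = 1"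
    then obtain M where "edges G \<noteq> {}" "M \<in> probe_matrices G N" "rank M = 1"
      using probe_mr_eq_1_iff_rank_1[OF G] by auto
    moreover from this obtain S where "clique_join_coclique G (S - N) (S \<inter> N)"
      using rank_1_imp_clique_join_coclique[OF assms(1)] by metis
    moreover have disjoint: "(S - N) \<inter> (S \<inter> N) = {}"
      by auto
    ultimately show ?rhs
      using clique_join_coclique_has_edge_iff[OF G, of "S - N" "S \<inter> N"] diff[OF disjoint]
      by (intro exI[of _ "S - N"] exI[of _ "S \<inter> N"]) auto
  next
    assume ?rhs
    then obtain A B where AB: "A \<inter> B = {}" "A \<noteq> {}" "card (A \<union> B) \<ge> 2"
        "clique_join_coclique G A B" "card B \<ge> 2 \<Longrightarrow> B \<subseteq> N"
      by blast
    then have "edges G \<noteq> {}"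
      using clique_join_coclique_has_edge_iff[OF G AB(4)] diff[OF AB(1)] by auto
    then show "probe_mr G N = 1"
      using clique_join_coclique_imp_rank_1[OF G assms(2) _ AB(4,5)] probe_mr_eq_1_iff_rank_1[OF G]
      by blast
  qed
qed

section \<open>The graph built by join and union\<close>

definition block_graph :: "nat \<Rightarrow> nat \<Rightarrow> nat \<Rightarrow> ((nat + nat) + nat) graph" where
  "block_graph a b c =
     graph_union
       (graph_join (complete_graph a) (graph_complement (complete_graph b)))
       (graph_complement (complete_graph c))"

lemma verts_graph_complement_complete: "verts (graph_complement (complete_graph m)) = {..<m}"
  by (simp add: graph_complement_def complete_graph_def)

lemma verts_block_graph: "verts (block_graph a b c) = ({..<a} <+> {..<b}) <+> {..<c}"
  by (simp add: block_graph_def graph_union_def graph_join_def graph_complement_def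
      complete_graph_def)

lemma edges_block_graph:
  "edges (block_graph a b c) =
     {{Inl (Inl i), Inl (Inl j)} | i j. i < a \<and> j < a \<and> i \<noteq> j} \<union>
     {{Inl (Inl i), Inl (Inr j)} | i j. i < a \<and> j < b}"
proof -
  have pairs: "all_edges {..<a} = {{i, j} | i j. i < a \<and> j < a \<and> i \<noteq> j}"
    by (auto simp: all_edges_def card_2_iff)
  have image_pairs: "image g ` {{p i j, q i j} | i j. P i j} = {{g (p i j), g (q i j)} | i j. P i j}"
    for g :: "'b \<Rightarrow> 'c" and p q :: "nat \<Rightarrow> nat \<Rightarrow> 'b" and P
  proof (intro set_eqI iffI)
    fix e assume "e \<in> {{g (p i j), g (q i j)} | i j. P i j}"
    then obtain i j where "e = g ` {p i j, q i j}" "P i j"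
      by auto
    then show "e \<in> image g ` {{p i j, q i j} | i j. P i j}"
      by blast
  qed auto
  have "edges (block_graph a b c) =
      image Inl ` image Inl ` all_edges {..<a} \<union>
      image Inl ` {{Inl i, Inr j} | i j. i < a \<and> j < b}"
    by (simp add: block_graph_def graph_union_def graph_join_def graph_complement_def
        complete_graph_def image_Un)
  then show ?thesis
    unfolding pairs image_pairs .
qed

lemma clique_join_coclique_block_graph:
  "clique_join_coclique (block_graph a b c) (Inl ` Inl ` {..<a}) (Inl ` Inr ` {..<b})"
  unfolding clique_join_coclique_def edges_block_graph Un_iff mem_Collect_eq doubleton_eq_iff
  by auto

lemma clique_join_coclique_transfer:
  assumes iso: "graph_iso f G H" and "simple_graph H"
    and G: "clique_join_coclique G A B" and AB: "A \<union> B \<subseteq> verts G"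
  shows "clique_join_coclique H (f ` A) (f ` B)"
proof -
  have bij: "bij_betw f (verts G) (verts H)"
    and edge: "\<And>x y. x \<in> verts G \<Longrightarrow> y \<in> verts G \<Longrightarrow>
      {f x, f y} \<in> edges H \<longleftrightarrow> {x, y} \<in> edges G"
    using iso by (auto simp: graph_iso_def)
  have inj: "inj_on f (verts G)" and range: "f ` verts G = verts H"
    using bij by (auto simp: bij_betw_def)
  have mem: "f x \<in> f ` C \<longleftrightarrow> x \<in> C" if "x \<in> verts G" "C \<subseteq> verts G" for x C
    using inj_on_image_mem_iff[OF inj that] .
  have sub: "A \<subseteq> verts G" "B \<subseteq> verts G"
    using AB by auto
  have on_verts: "{f x, f y} \<in> edges H \<longleftrightarrow> f x \<noteq> f y \<and> f x \<in> f ` A \<union> f ` B \<and>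
      f y \<in> f ` A \<union> f ` B \<and> \<not> (f x \<in> f ` B \<and> f y \<in> f ` B)"
    if "x \<in> verts G" "y \<in> verts G" for x y
    using G that mem sub inj_on_eq_iff[OF inj that] edge[OF that]
    by (simp add: clique_join_coclique_def)
  have "{u, v} \<in> edges H \<longleftrightarrow> u \<noteq> v \<and> u \<in> f ` A \<union> f ` B \<and>
      v \<in> f ` A \<union> f ` B \<and> \<not> (u \<in> f ` B \<and> v \<in> f ` B)" for u v
  proof (cases "u \<in> verts H \<and> v \<in> verts H")
    case True
    then obtain x y where "x \<in> verts G" "y \<in> verts G" and "u = f x" "v = f y"
      using range by blast
    then show ?thesis
      using on_verts by simp
  next
    case False
    then show ?thesis
      using simple_graph_edge_in_verts[OF assms(2)] sub range by blast
  qed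
  then show ?thesis
    by (simp add: clique_join_coclique_def)
qed

text \<open>Enumerating \<open>A\<close>, \<open>B\<close> and the remaining vertices gives the three components of the isomorphism.\<close>

lemma ex_graph_iso_block_graph:
  assumes "finite (verts G)" and "A \<inter> B = {}" and "A \<union> B \<subseteq> verts G"
    and G: "clique_join_coclique G A B"
  obtains f where
    "graph_iso f (block_graph (card A) (card B) (card (verts G - (A \<union> B)))) G"
    and "(\<lambda>v. f (Inl (Inr v))) ` {..<card B} = B"
proof -
  let ?C = "verts G - (A \<union> B)"
  have "finite A" "finite B" "finite ?C"
    using assms(1,3) by (auto intro: finite_subset)
  then obtain fA fB fC where f: "bij_betw fA {..<card A} A" "bij_betw fB {..<card B} B"
      "bij_betw fC {..<card ?C} ?C"
    using ex_bij_betw_nat_finite by (metis atLeast0LessThan)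
  define f where "f = case_sum (case_sum fA fB) fC"
  let ?M = "block_graph (card A) (card B) (card ?C)"
  have im: "fA ` {..<card A} = A" "fB ` {..<card B} = B" "fC ` {..<card ?C} = ?C"
    using f by (auto simp: bij_betw_def)
  have inj: "inj_on fA {..<card A}" "inj_on fB {..<card B}" "inj_on fC {..<card ?C}"
    using f by (auto simp: bij_betw_def)
  have mem: "i < card A \<Longrightarrow> fA i \<in> A" "i < card B \<Longrightarrow> fB i \<in> B"
      "i < card ?C \<Longrightarrow> fC i \<in> ?C" for i
    using im by blast+
  have distinct: "i < card A \<Longrightarrow> j < card B \<Longrightarrow> fA i \<noteq> fB j"
      "i < card A \<Longrightarrow> j < card ?C \<Longrightarrow> fA i \<noteq> fC j"
      "i < card B \<Longrightarrow> j < card ?C \<Longrightarrow> fB i \<noteq> fC j" for i j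
    using mem assms(2) by (metis disjoint_iff, metis DiffD2 UnI1, metis DiffD2 UnI2)
  have "inj_on f (verts ?M)"
  proof (rule inj_onI)
    fix x y assume "x \<in> verts ?M" "y \<in> verts ?M" "f x = f y"
    then show "x = y"
      using inj
      by (auto simp: verts_block_graph f_def inj_on_eq_iff distinct distinct[symmetric])
  qed
  moreover have "f ` verts ?M = verts G"
    using im assms(3) by (auto simp: verts_block_graph f_def Plus_def image_Un image_image)
  ultimately have bij: "bij_betw f (verts ?M) (verts G)"
    by (simp add: bij_betw_def)
  have fA_iff: "f x \<in> A \<longleftrightarrow> x \<in> Inl ` Inl ` {..<card A}"
    and fB_iff: "f x \<in> B \<longleftrightarrow> x \<in> Inl ` Inr ` {..<card B}" if "x \<in> verts ?M" for x
    using that mem assms(2) by (fastforce simp: verts_block_graph f_def)+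
  have "{x, y} \<in> edges ?M \<longleftrightarrow> {f x, f y} \<in> edges G" if "x \<in> verts ?M" "y \<in> verts ?M" for x y
  proof -
    have "f x = f y \<longleftrightarrow> x = y"
      using bij that by (auto simp: bij_betw_def inj_on_eq_iff)
    then show ?thesis
      using G clique_join_coclique_block_graph[of "card A" "card B" "card ?C"]
        fA_iff[OF that(1)] fA_iff[OF that(2)] fB_iff[OF that(1)] fB_iff[OF that(2)]
      unfolding clique_join_coclique_def by (simp only: Un_iff)
  qed
  then have "graph_iso f ?M G"
    using bij by (simp add: graph_iso_def)
  then show ?thesis
    using that im(2) by (simp add: f_def)
qed

theorem theorem5p2:
  fixes G :: "'n::finite graph" and N :: "'n set" and n :: nat
  assumes "probe_graph G N" and "verts G = UNIV" and "card (verts G) = n"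
  shows "probe_mr G N = 1 \<longleftrightarrow>
    (\<exists>a b c :: nat. \<exists>f :: (nat + nat) + nat \<Rightarrow> 'n.
       graph_iso f
         (graph_union
            (graph_join (complete_graph a) (graph_complement (complete_graph b)))
            (graph_complement (complete_graph c))) G \<and>
       a + b + c = n \<and> a > 0 \<and> a + b \<ge> 2 \<and>
       (b \<ge> 2 \<longrightarrow>
          (\<lambda>v. f (Inl (Inr v))) ` verts (graph_complement (complete_graph b)) \<subseteq> N))"
  (is "_ \<longleftrightarrow> ?rhs")
proof -
  have G: "simple_graph G"
    using assms(1) by (simp add: probe_graph_def)
  have "?rhs \<longleftrightarrow> (\<exists>A B. A \<inter> B = {} \<and> A \<noteq> {} \<and> card (A \<union> B) \<ge> 2 \<and>
      clique_join_coclique G A B \<and> (card B \<ge> 2 \<longrightarrow> B \<subseteq> N))" (is "_ \<longleftrightarrow> ?sets")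
  proof
    assume ?rhs
    then obtain a b c f where iso: "graph_iso f (block_graph a b c) G"
      and a: "a > 0" "a + b \<ge> 2" and B_N: "b \<ge> 2 \<Longrightarrow> (\<lambda>v. f (Inl (Inr v))) ` {..<b} \<subseteq> N"
      unfolding block_graph_def[symmetric] verts_graph_complement_complete by blast
    let ?A = "Inl ` Inl ` {..<a} :: ((nat + nat) + nat) set"
    let ?B = "Inl ` Inr ` {..<b} :: ((nat + nat) + nat) set"
    have sub: "?A \<union> ?B \<subseteq> verts (block_graph a b c)"
      by (auto simp: verts_block_graph)
    have inj: "inj_on f (?A \<union> ?B)"
      using iso inj_on_subset[OF _ sub] by (auto simp: graph_iso_def bij_betw_def)
    have card_A: "card ?A = a" and card_B: "card ?B = b"
      by (simp_all add: card_image)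
    have disjoint: "?A \<inter> ?B = {}"
      by auto
    have "f ` ?A \<inter> f ` ?B = {}"
      using inj_on_image_Int[OF inj, of ?A ?B] disjoint by auto
    moreover have "f ` ?A \<noteq> {}"
      using a(1) by auto
    moreover have "card (f ` ?A \<union> f ` ?B) \<ge> 2"
      using card_image[OF inj] card_Un_disjoint[OF _ _ disjoint] card_A card_B a(2)
      by (simp add: image_Un)
    moreover have "clique_join_coclique G (f ` ?A) (f ` ?B)"
      using clique_join_coclique_transfer[OF iso G clique_join_coclique_block_graph sub] .
    moreover have "card (f ` ?B) = b"
      using card_image[of f ?B] inj card_B by (simp add: inj_on_Un)
    then have "card (f ` ?B) \<ge> 2 \<longrightarrow> f ` ?B \<subseteq> N"
      using B_N by (simp add: image_image)
    ultimately show ?sets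
      by blast
  next
    assume ?sets
    then obtain A B where AB: "A \<inter> B = {}" "A \<noteq> {}" "card (A \<union> B) \<ge> 2"
        "clique_join_coclique G A B" "card B \<ge> 2 \<longrightarrow> B \<subseteq> N"
      by blast
    let ?C = "verts G - (A \<union> B)"
    have sub: "A \<union> B \<subseteq> verts G" and fin: "finite (verts G)"
      using assms(2) by auto
    obtain f where "graph_iso f (block_graph (card A) (card B) (card ?C)) G"
      and "(\<lambda>v. f (Inl (Inr v))) ` {..<card B} = B"
      using ex_graph_iso_block_graph[OF fin AB(1) sub AB(4)] by metis
    moreover have card_AB: "card (A \<union> B) = card A + card B"
      using AB(1) by (simp add: card_Un_disjoint)
    moreover have "card A + card B + card ?C = n"
      using card_AB assms(3) card_Diff_subset[OF _ sub] card_mono[OF fin sub] by simp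
    ultimately show ?rhs
      using AB unfolding block_graph_def[symmetric] verts_graph_complement_complete
      by (intro exI[of _ "card A"] exI[of _ "card B"] exI[of _ "card ?C"] exI[of _ f])
        (simp add: card_gt_0_iff)
  qed
  then show ?thesis
    by (rule trans[OF probe_mr_eq_1_iff[OF assms(1,2)] sym])
qed

end
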